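(* $\mathrm X_G$ is reconstructible; that is, $\mathrm X_G$ is determined by the list of vertex-deleted subgraphs of the graph $G$.
   Context: A graph is a finite simple labelled undirected graph. The list of vertex-deleted subgraphs of a graph $G$ is the multiset of unlabelled graphs $\{G\setminus v\mid v\in V(G)\}$. A quantity associated with a graph $G$ is called reconstructible if it is determined by the list of vertex-deleted subgraphs of $G$. A stable partition of $G$ is a partition of $V(G)$ such that no two vertices in the same block are connected by an edge. For an integer partition $\lambda$ with $r_i$ parts equal to $i$, $\tilde m_\lambda=(r_1!\,r_2!\cdots)\,m_\lambda$, where $m_\lambda$ is the monomial symmetric function in countably many commuting variables $x_1,x_2,\dots$; a set partition in a subscript stands for the integer partition formed by its block sizes. The chromatic symmetric function of $G$ is $\mathrm X_G=\sum_\pi\tilde m_\pi$, where the sum is over all stable partitions $\pi$ of $G$.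
   Formalization: Graphs with exactly two vertices are excluded, since the claim fails there: the complete and the edgeless graph on two vertices have the same list of vertex-deleted subgraphs but different chromatic symmetric functions. *)

theory Defs
  imports
    "Graph_Theory.Graph_Theory"
    "HOL-Library.Multiset"
    "HOL-Library.Disjoint_Sets"
    "HOL-Library.Poly_Mapping"
begin

text \<open>
  A finite simple undirected graph is a \<^typ>\<open>'a pair_pre_digraph\<close> satisfying
  \<^const>\<open>pair_graph\<close>: its vertex set is finite and its arcs form an irreflexive symmetric
  relation on that set.
\<close>

text \<open>
  An unlabelled graph is an isomorphism class. Its members are taken with vertices in
  \<^typ>\<open>nat\<close>, where every finite graph has a copy, so that graphs with different vertex types
  have comparable classes.
\<close>

definition unlabelled :: "('a, 'b) pre_digraph \<Rightarrow> nat pair_pre_digraph set" where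
  "unlabelled G = {H. digraph_iso G (with_proj H)}"

text \<open>
  The complete graph and the edgeless graph on two vertices have the same deck but different
  chromatic symmetric functions.
\<close>

definition deck :: "'a pair_pre_digraph \<Rightarrow> nat pair_pre_digraph set multiset" where
  "deck G = {# unlabelled (pre_digraph.del_vert (with_proj G) v). v \<in># mset_set (pverts G) #}"

definition stable_partition :: "'a pair_pre_digraph \<Rightarrow> 'a set set \<Rightarrow> bool" where
  "stable_partition G \<pi> \<longleftrightarrow>
     partition_on (pverts G) \<pi> \<and> (\<forall>B\<in>\<pi>. \<forall>u\<in>B. \<forall>v\<in>B. (u, v) \<notin> parcs G)"

definition block_sizes :: "'a set set \<Rightarrow> nat multiset" where
  "block_sizes \<pi> = {# card B. B \<in># mset_set \<pi> #}"

text \<open>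
  A formal power series in countably many commuting variables is given by its coefficients; a
  monomial is given by its finitely supported exponent vector \<open>\<alpha>\<close>. Integer partitions are
  multisets of positive numbers.
\<close>

type_synonym power_series = "(nat \<Rightarrow>\<^sub>0 nat) \<Rightarrow> int"

definition monomial_symmetric :: "nat multiset \<Rightarrow> power_series" where
  "monomial_symmetric \<mu> = (\<lambda>\<alpha>.
     if {# Poly_Mapping.lookup \<alpha> i. i \<in># mset_set (Poly_Mapping.keys \<alpha>) #} = \<mu> then 1 else 0)"

definition augmented_monomial_symmetric :: "nat multiset \<Rightarrow> power_series" where
  "augmented_monomial_symmetric \<mu> = (\<lambda>\<alpha>.
     (\<Prod>i\<in>set_mset \<mu>. fact (count \<mu> i)) * monomial_symmetric \<mu> \<alpha>)"

definition chromatic_symmetric_function :: "'a pair_pre_digraph \<Rightarrow> power_series" where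
  "chromatic_symmetric_function G = (\<lambda>\<alpha>.
     \<Sum>\<pi> | stable_partition G \<pi>. augmented_monomial_symmetric (block_sizes \<pi>) \<alpha>)"

end

theory Submission
  imports Defs
begin

text \<open>
  A stable partition of \<open>V(G)\<close> with block sizes \<open>\<mu>\<close> is the same as a family of nonempty stable
  sets with sizes \<open>\<mu>\<close> whose union is \<open>V(G)\<close>, provided that the parts of \<open>\<mu>\<close> sum to
  \<open>n = \<bar>V(G)\<bar>\<close>: there is then no room for an overlap. For other \<open>\<mu>\<close> there are no
  such partitions. The coefficient of a monomial of type \<open>\<mu>\<close> in the chromatic symmetric
  function is a constant multiple of the number of such partitions, so it suffices to reconstruct the number of
  families with sizes \<open>\<mu>\<close> and union \<open>V(G)\<close>. This is an instance of Kocay's argument. Two counts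
  of families with sizes \<open>\<mu>\<close> are available from the deck.

  Firstly, the families whose union has exactly \<open>j < n\<close> elements: such a family survives in
  exactly \<open>n - j\<close> of the vertex-deleted subgraphs, so adding the counts over the deck gives
  \<open>n - j\<close> times the wanted number (Kelly's lemma, \<open>support_count_del_vert\<close> and
  \<open>support_count_eq_if_deck_eq\<close>).

  Secondly, the families with an arbitrary union: their number depends only on how many stable
  sets of each size there are (\<open>card_stable_families_cong\<close>). For sizes below \<open>n\<close> these
  numbers are again given by Kelly's lemma, applied to families with a single member. The whole
  vertex set is stable iff all pairs of vertices are, which is visible from the sets of size 2
  if \<open>n > 2\<close>, and it is stable for \<open>n = 1\<close>; only \<open>n = 2\<close> escapes.

  Subtracting the families with union smaller than \<open>V(G)\<close> from all families leaves those with
  union \<open>V(G)\<close>.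
\<close>

section \<open>Families of stable sets\<close>

text \<open>
  Vertex deletion and isomorphism are operations on general digraphs, hence the generality. The
  empty set is excluded since blocks of a partition are nonempty.
\<close>

definition stable_sets :: "('a, 'b) pre_digraph \<Rightarrow> 'a set set" where
  "stable_sets G = {A. A \<noteq> {} \<and> A \<subseteq> verts G \<and> (\<forall>u\<in>A. \<forall>v\<in>A. (u, v) \<notin> arcs_ends G)}"

definition stable_families :: "('a, 'b) pre_digraph \<Rightarrow> nat multiset \<Rightarrow> 'a set set set" where
  "stable_families G \<mu> = {F. F \<subseteq> stable_sets G \<and> block_sizes F = \<mu>}"

definition support_count :: "('a, 'b) pre_digraph \<Rightarrow> nat multiset \<Rightarrow> nat \<Rightarrow> nat" where
  "support_count G \<mu> j = card {F \<in> stable_families G \<mu>. card (\<Union>F) = j}"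

lemma card_stable_set_le: "finite (verts G) \<Longrightarrow> A \<in> stable_sets G \<Longrightarrow> card A \<le> card (verts G)"
  by (auto simp: stable_sets_def intro: card_mono)

lemma finite_stable_sets: "finite (verts G) \<Longrightarrow> finite (stable_sets G)"
  by (rule finite_subset[of _ "Pow (verts G)"]) (auto simp: stable_sets_def)

lemma finite_stable_families: "finite (verts G) \<Longrightarrow> finite (stable_families G \<mu>)"
  by (rule finite_subset[of _ "Pow (stable_sets G)"])
    (auto simp: stable_families_def finite_stable_sets)

lemma Union_stable_family_subset: "F \<in> stable_families G \<mu> \<Longrightarrow> \<Union>F \<subseteq> verts G"
  by (auto simp: stable_families_def stable_sets_def)

lemma block_sizes_image:
  assumes "inj_on \<phi> F" and "\<And>A. A \<in> F \<Longrightarrow> card (\<phi> A) = card A"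
  shows "block_sizes (\<phi> ` F) = block_sizes F"
proof -
  have "block_sizes (\<phi> ` F) = image_mset card (image_mset \<phi> (mset_set F))"
    using assms(1) by (simp add: block_sizes_def image_mset_mset_set)
  also have "\<dots> = image_mset (\<lambda>A. card (\<phi> A)) (mset_set F)"
    by (simp add: multiset.map_comp o_def)
  also have "\<dots> = image_mset card (mset_set F)"
    by (cases "finite F") (auto intro!: image_mset_cong simp: assms(2))
  finally show ?thesis
    by (simp add: block_sizes_def)
qed

lemma sum_mset_block_sizes: "\<Sum>\<^sub># (block_sizes F) = (\<Sum>A\<in>F. card A)"
  by (simp add: block_sizes_def sum_unfold_sum_mset)

lemma bij_betw_stable_families:
  assumes \<phi>: "bij_betw \<phi> (stable_sets G) (stable_sets H)"
    and card: "\<And>A. A \<in> stable_sets G \<Longrightarrow> card (\<phi> A) = card A"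
  shows "bij_betw ((`) \<phi>) (stable_families G \<mu>) (stable_families H \<mu>)"
proof -
  have Pow: "bij_betw ((`) \<phi>) (Pow (stable_sets G)) (Pow (stable_sets H))"
    using \<phi> by (rule bij_betw_image_Pow)
  have sizes: "block_sizes (\<phi> ` F) = block_sizes F" if "F \<subseteq> stable_sets G" for F
    using that \<phi> card by (intro block_sizes_image) (auto simp: bij_betw_def intro: inj_on_subset)
  have "(`) \<phi> ` stable_families G \<mu> = stable_families H \<mu>"
  proof (intro equalityI subsetI)
    fix F assume "F \<in> (`) \<phi> ` stable_families G \<mu>"
    then show "F \<in> stable_families H \<mu>"
      using \<phi> sizes by (auto simp: stable_families_def bij_betw_def)
  next
    fix F assume F: "F \<in> stable_families H \<mu>"
    then have "F \<in> (`) \<phi> ` Pow (stable_sets G)"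
      using Pow by (simp add: bij_betw_def stable_families_def)
    then obtain E where "E \<subseteq> stable_sets G" "F = \<phi> ` E"
      by auto
    then show "F \<in> (`) \<phi> ` stable_families G \<mu>"
      using F sizes by (auto simp: stable_families_def)
  qed
  moreover have "stable_families G \<mu> \<subseteq> Pow (stable_sets G)"
    by (auto simp: stable_families_def)
  ultimately show ?thesis
    using Pow by (auto simp: bij_betw_def intro: inj_on_subset)
qed

lemma bij_betw_if_card_fibres_eq:
  fixes g :: "'a \<Rightarrow> 'c" and h :: "'b \<Rightarrow> 'c"
  assumes "finite X" "finite Y"
    and "\<And>j. card {x \<in> X. g x = j} = card {y \<in> Y. h y = j}"
  shows "\<exists>\<phi>. bij_betw \<phi> X Y \<and> (\<forall>x\<in>X. h (\<phi> x) = g x)"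
proof -
  have "\<exists>\<psi>. bij_betw \<psi> {x \<in> X. g x = j} {y \<in> Y. h y = j}" for j
    using assms by (intro finite_same_card_bij) auto
  then obtain \<psi> where \<psi>: "\<And>j. bij_betw (\<psi> j) {x \<in> X. g x = j} {y \<in> Y. h y = j}"
    by metis
  let ?\<phi> = "\<lambda>x. \<psi> (g x) x"
  have maps: "?\<phi> x \<in> Y \<and> h (?\<phi> x) = g x" if "x \<in> X" for x
    using bij_betwE[OF \<psi>[of "g x"]] that by auto
  have "inj_on ?\<phi> X"
  proof (rule inj_onI)
    fix x y assume xy: "x \<in> X" "y \<in> X" and eq: "?\<phi> x = ?\<phi> y"
    then have "g x = g y"
      using maps by metis
    then show "x = y"
      using bij_betw_imp_inj_on[OF \<psi>[of "g x"]] xy eq by (auto dest: inj_onD)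
  qed
  moreover have "Y \<subseteq> ?\<phi> ` X"
  proof
    fix y assume "y \<in> Y"
    then have "y \<in> \<psi> (h y) ` {x \<in> X. g x = h y}"
      using bij_betw_imp_surj_on[OF \<psi>[of "h y"]] by simp
    then obtain x where "x \<in> X" "g x = h y" "y = \<psi> (h y) x"
      by auto
    then show "y \<in> ?\<phi> ` X"
      by (intro image_eqI[of _ _ x]) auto
  qed
  ultimately have "bij_betw ?\<phi> X Y"
    using maps by (auto simp: bij_betw_def)
  then show ?thesis
    using maps by blast
qed

text \<open>
  Matching the stable sets of the two graphs size by size carries families to families. This
  replaces the formula that writes the count as a product of binomial coefficients.
\<close>

lemma card_stable_families_cong:
  assumes "finite (verts G)" "finite (verts H)"
    and "\<And>j. card {A \<in> stable_sets G. card A = j} = card {A \<in> stable_sets H. card A = j}"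
  shows "card (stable_families G \<mu>) = card (stable_families H \<mu>)"
proof -
  obtain \<phi> where "bij_betw \<phi> (stable_sets G) (stable_sets H)"
      "\<forall>A\<in>stable_sets G. card (\<phi> A) = card A"
    using bij_betw_if_card_fibres_eq[OF finite_stable_sets finite_stable_sets] assms by blast
  then show ?thesis
    by (intro bij_betw_same_card[OF bij_betw_stable_families]) auto
qed

text \<open>
  Stable sets of size \<open>j\<close> are counted here as families with one member, so that Kelly's lemma for
  families covers them too.
\<close>

lemma support_count_singleton:
  assumes "finite (verts G)"
  shows "support_count G {#j#} j = card {A \<in> stable_sets G. card A = j}"
proof -
  have "{F \<in> stable_families G {#j#}. card (\<Union>F) = j}
      = (\<lambda>A. {A}) ` {A \<in> stable_sets G. card A = j}" (is "?L = ?R")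
  proof (intro equalityI subsetI)
    fix F assume F: "F \<in> ?L"
    then have "block_sizes F = {#j#}" and sub: "F \<subseteq> stable_sets G"
      by (auto simp: stable_families_def)
    moreover have "finite F"
      using sub finite_stable_sets[OF assms] by (rule finite_subset)
    ultimately have "card F = 1"
      by (metis block_sizes_def size_image_mset size_mset_set size_single)
    then obtain A where "F = {A}"
      by (auto simp: card_1_singleton_iff)
    then show "F \<in> ?R"
      using F sub by auto
  qed (auto simp: stable_families_def block_sizes_def)
  then show ?thesis
    by (simp add: support_count_def card_image)
qed

lemma card_stable_families_eq_sum:
  assumes "finite (verts G)"
  shows "card (stable_families G \<mu>) = (\<Sum>j\<le>card (verts G). support_count G \<mu> j)"
proof -
  have "card (\<Union>F) \<le> card (verts G)" if "F \<in> stable_families G \<mu>" for F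
    using assms Union_stable_family_subset[OF that] by (rule card_mono)
  then show ?thesis
    unfolding support_count_def card_eq_sum
    by (subst sum.group) (auto simp: assms finite_stable_families)
qed

section \<open>Kelly's lemma\<close>

lemma stable_families_del_vert:
  "stable_families (pre_digraph.del_vert G v) \<mu> = {F \<in> stable_families G \<mu>. v \<notin> \<Union>F}"
proof -
  have "stable_sets (pre_digraph.del_vert G v) = {A \<in> stable_sets G. v \<notin> A}"
  proof -
    \<comment> \<open>Deleting \<open>v\<close> removes the pairs that contain \<open>v\<close>, and a set without \<open>v\<close> contains none.\<close>
    have "arcs_ends (pre_digraph.del_vert G v) = {(u, w) \<in> arcs_ends G. u \<noteq> v \<and> w \<noteq> v}"
      by (auto simp: pre_digraph.del_vert_simps arcs_ends_conv)
    then show ?thesis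
      by (auto simp: stable_sets_def pre_digraph.del_vert_simps)
  qed
  then show ?thesis
    by (auto simp: stable_families_def)
qed

text \<open>
  A family with a union of \<open>j\<close> elements avoids a deleted vertex \<open>v\<close> for exactly \<open>n - j\<close>
  choices of \<open>v\<close>; the sum counts such pairs.
\<close>

lemma support_count_del_vert:
  assumes fin: "finite (verts G)"
  shows "(\<Sum>v\<in>verts G. support_count (pre_digraph.del_vert G v) \<mu> j)
    = (card (verts G) - j) * support_count G \<mu> j"
proof -
  define X where "X = {F \<in> stable_families G \<mu>. card (\<Union>F) = j}"
  have "finite X"
    using fin by (simp add: X_def finite_stable_families)
  have "support_count (pre_digraph.del_vert G v) \<mu> j = card {F \<in> X. v \<notin> \<Union>F}" for v
    unfolding support_count_def stable_families_del_vert X_def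
    by (intro arg_cong[where f = card]) auto
  moreover have "(\<Sum>v\<in>verts G. card {F \<in> X. v \<notin> \<Union>F}) = (card (verts G) - j) * card X"
  proof (rule sum_multicount[OF fin \<open>finite X\<close>], intro ballI)
    fix F assume "F \<in> X"
    then have "\<Union>F \<subseteq> verts G" "card (\<Union>F) = j"
      using Union_stable_family_subset[of F G \<mu>] by (simp_all add: X_def)
    moreover have "{v \<in> verts G. v \<notin> \<Union>F} = verts G - \<Union>F"
      by auto
    ultimately show "card {v \<in> verts G. v \<notin> \<Union>F} = card (verts G) - j"
      using fin by (simp add: card_Diff_subset finite_subset)
  qed
  ultimately show ?thesis
    by (simp add: support_count_def X_def)
qed

section \<open>Reconstruction from the deck\<close>

lemma support_count_iso:
  assumes "digraph_iso G K"
  shows "support_count G \<mu> j = support_count K \<mu> j"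
proof -
  obtain f where f: "pre_digraph.digraph_isomorphism G f" and K: "K = app_iso f G"
    using assms by (auto simp: digraph_iso_def)
  let ?h = "iso_verts f"
  interpret wf_digraph G
    using f by (simp add: pre_digraph.digraph_isomorphism_def)
  have inj: "inj_on ?h (verts G)"
    using f by (rule digraph_isomorphism_inj_on_verts)
  have arc: "(?h u, ?h v) \<in> arcs_ends K \<longleftrightarrow> (u, v) \<in> arcs_ends G"
    if "u \<in> verts G" "v \<in> verts G" for u v
  proof -
    have "a = u \<and> b = v"
      if "(a, b) \<in> arcs_ends G" "?h u = ?h a" "?h v = ?h b" for a b
      using that adj_in_verts[OF that(1)] inj \<open>u \<in> verts G\<close> \<open>v \<in> verts G\<close>
      by (auto dest: inj_onD)
    then show ?thesis
      unfolding K arcs_ends_app_iso_eq[OF f] by force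
  qed
  have stable: "?h ` A \<in> stable_sets K \<longleftrightarrow> A \<in> stable_sets G" if "A \<subseteq> verts G" for A
    using that arc by (auto simp: stable_sets_def K subset_iff)
  have Pow: "bij_betw ((`) ?h) (Pow (verts G)) (Pow (verts K))"
    using inj by (intro bij_betw_image_Pow) (simp add: bij_betw_def K)
  have sub: "stable_sets G \<subseteq> Pow (verts G)" "stable_sets K \<subseteq> Pow (verts K)"
    by (auto simp: stable_sets_def)
  have "(`) ?h ` stable_sets G = stable_sets K"
  proof (intro equalityI subsetI)
    fix B assume B: "B \<in> stable_sets K"
    then have "B \<in> (`) ?h ` Pow (verts G)"
      using sub Pow by (auto simp: bij_betw_def)
    then show "B \<in> (`) ?h ` stable_sets G"
      using B stable by auto
  qed (use sub stable in auto)
  then have bij: "bij_betw ((`) ?h) (stable_sets G) (stable_sets K)"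
    using Pow sub(1) by (auto simp: bij_betw_def intro: inj_on_subset)
  have card: "card (?h ` A) = card A" if "A \<subseteq> verts G" for A
    using inj that by (intro card_image) (rule inj_on_subset)
  have fam: "bij_betw ((`) ((`) ?h)) (stable_families G \<mu>) (stable_families K \<mu>)"
    using bij by (rule bij_betw_stable_families) (use sub card in auto)
  have "card (\<Union> ((`) ?h ` F)) = card (\<Union>F)" if "F \<in> stable_families G \<mu>" for F
    using card[OF Union_stable_family_subset[OF that]] by (simp add: image_Union)
  then have "(`) ((`) ?h) ` {F \<in> stable_families G \<mu>. card (\<Union>F) = j}
      = {F \<in> stable_families K \<mu>. card (\<Union>F) = j}"
    unfolding bij_betw_imp_surj_on[OF fam, symmetric] by auto
  then have "bij_betw ((`) ((`) ?h)) {F \<in> stable_families G \<mu>. card (\<Union>F) = j}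
      {F \<in> stable_families K \<mu>. card (\<Union>F) = j}"
    using fam by (auto simp: bij_betw_def intro: inj_on_subset)
  then show ?thesis
    unfolding support_count_def by (rule bij_betw_same_card)
qed

text \<open>
  By this lemma a choice from the isomorphism class of a card yields a graph isomorphic to the
  card. As graphs in \<^const>\<open>unlabelled\<close> have arcs that are pairs, parallel arcs are excluded.
\<close>

lemma unlabelled_nonempty:
  assumes "wf_digraph G" "finite (verts G)" "inj_on (arc_to_ends G) (arcs G)"
  shows "unlabelled G \<noteq> {}"
proof -
  obtain h :: "'a \<Rightarrow> nat" where h: "inj_on h (verts G)"
    using finite_imp_inj_to_nat_seg[OF assms(2)] by blast
  let ?f = "\<lparr>iso_verts = h, iso_arcs = (\<lambda>a. (h (tail G a), h (head G a))),
    iso_head = snd, iso_tail = fst\<rparr>"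
  have wf: "tail G a \<in> verts G \<and> head G a \<in> verts G" if "a \<in> arcs G" for a
    using assms(1) that by (simp add: wf_digraph_def)
  have "inj_on (\<lambda>a. (h (tail G a), h (head G a))) (arcs G)"
  proof (rule inj_onI)
    fix a b assume ab: "a \<in> arcs G" "b \<in> arcs G"
      and eq: "(h (tail G a), h (head G a)) = (h (tail G b), h (head G b))"
    then have "arc_to_ends G a = arc_to_ends G b"
      using h wf by (auto simp: arc_to_ends_def inj_on_eq_iff)
    then show "a = b"
      using assms(3) ab by (auto dest: inj_onD)
  qed
  then have "pre_digraph.digraph_isomorphism G ?f"
    using assms(1) h by (simp add: pre_digraph.digraph_isomorphism_def)
  moreover have "with_proj \<lparr>pverts = h ` verts G, parcs = iso_arcs ?f ` arcs G\<rparr> = app_iso ?f G"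
    by (simp add: with_proj_def app_iso_def)
  ultimately have "digraph_iso G (with_proj \<lparr>pverts = h ` verts G, parcs = iso_arcs ?f ` arcs G\<rparr>)"
    unfolding digraph_iso_def by metis
  then show ?thesis
    by (auto simp: unlabelled_def)
qed

text \<open>
  The counts are isomorphism invariants, so each card can be replaced by any member of its
  isomorphism class. The right-hand side depends on \<open>G\<close> through its deck only.
\<close>

lemma sum_support_count_deck:
  assumes "pair_graph G"
  shows "(\<Sum>v\<in>pverts G. support_count (pre_digraph.del_vert (with_proj G) v) \<mu> j)
    = (\<Sum>c\<in>#deck G. support_count (with_proj (SOME K. K \<in> c)) \<mu> j)"
proof -
  interpret pair_graph G by fact
  have "support_count (pre_digraph.del_vert (with_proj G) v) \<mu> j
      = support_count (with_proj (SOME K. K \<in> unlabelled (pre_digraph.del_vert (with_proj G) v))) \<mu> j"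
    for v
  proof (rule support_count_iso)
    let ?D = "pre_digraph.del_vert (with_proj G) v"
    have "unlabelled ?D \<noteq> {}"
      by (intro unlabelled_nonempty)
        (auto simp: wf_digraph_del_vert del_vert_simps arc_to_ends_def intro: inj_onI)
    then have "(SOME K. K \<in> unlabelled ?D) \<in> unlabelled ?D"
      by (rule some_in_eq[THEN iffD2])
    then show "digraph_iso ?D (with_proj (SOME K. K \<in> unlabelled ?D))"
      by (simp add: unlabelled_def)
  qed
  then show ?thesis
    by (simp add: deck_def multiset.map_comp o_def sum_unfold_sum_mset)
qed

lemma size_deck: "size (deck G) = card (pverts G)"
  by (simp add: deck_def)

lemma support_count_eq_if_deck_eq:
  assumes G: "pair_graph G" and H: "pair_graph H" and deck: "deck G = deck H"
    and j: "j < card (pverts G)"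
  shows "support_count (with_proj G) \<mu> j = support_count (with_proj H) \<mu> j"
proof -
  have fin: "finite (pverts G)" "finite (pverts H)"
    using G H by (auto simp: pair_graph_def pair_digraph_def pair_fin_digraph_def
        pair_fin_digraph_axioms_def)
  have n: "card (pverts H) = card (pverts G)"
    using deck size_deck by metis
  have "(card (pverts G) - j) * support_count (with_proj G) \<mu> j
      = (\<Sum>v\<in>pverts G. support_count (pre_digraph.del_vert (with_proj G) v) \<mu> j)"
    using support_count_del_vert[of "with_proj G"] fin by simp
  also have "\<dots> = (\<Sum>v\<in>pverts H. support_count (pre_digraph.del_vert (with_proj H) v) \<mu> j)"
    using sum_support_count_deck[OF G] sum_support_count_deck[OF H] deck by simp
  also have "\<dots> = (card (pverts G) - j) * support_count (with_proj H) \<mu> j"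
    using support_count_del_vert[of "with_proj H"] fin n by simp
  finally show ?thesis
    using j by simp
qed

section \<open>Counting stable sets\<close>

text \<open>
  The whole vertex set is stable iff every pair of distinct vertices is, as there are no loops. It
  is too large for Kelly's lemma, whereas the pairs are within its reach if \<open>n > 2\<close>.
\<close>

lemma verts_stable_iff_pairs_stable:
  assumes G: "pair_graph G" and n: "card (pverts G) \<ge> 2"
  shows "pverts G \<in> stable_sets (with_proj G) \<longleftrightarrow>
    card {A \<in> stable_sets (with_proj G). card A = 2} = card (pverts G) choose 2"
    (is "?stable \<longleftrightarrow> card ?S = _")
proof -
  interpret pair_graph G by fact
  let ?P = "{A. A \<subseteq> pverts G \<and> card A = 2}"
  have fin: "finite (pverts G)"
    by (rule pair_finite_verts)
  have sub: "?S \<subseteq> ?P"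
    by (auto simp: stable_sets_def)
  have "card ?S = card (pverts G) choose 2 \<longleftrightarrow> ?S = ?P"
    using card_subset_eq[OF _ sub] n_subsets[OF fin, of 2] fin by auto
  also have "\<dots> \<longleftrightarrow> ?stable"
  proof
    assume eq: "?S = ?P"
    have "(u, v) \<notin> parcs G" if uv: "u \<in> pverts G" "v \<in> pverts G" for u v
    proof (cases "u = v")
      case True
      then show ?thesis
        using pair_no_loops[of "(u, v)"] by auto
    next
      case False
      then have "{u, v} \<in> ?S"
        using uv unfolding eq by simp
      then show ?thesis
        by (auto simp: stable_sets_def)
    qed
    then show ?stable
      using n by (auto simp: stable_sets_def)
  next
    assume ?stable
    then show "?S = ?P"
      by (auto simp: stable_sets_def)
  qed
  finally show ?thesis
    by simp
qed

lemma card_stable_sets_eq_if_deck_eq: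
  assumes G: "pair_graph G" and H: "pair_graph H" and deck: "deck G = deck H"
    and not_2: "card (pverts G) \<noteq> 2"
  shows "card {A \<in> stable_sets (with_proj G). card A = j}
    = card {A \<in> stable_sets (with_proj H). card A = j}"
proof -
  interpret G: pair_graph G by fact
  interpret H: pair_graph H by fact
  have n: "card (pverts H) = card (pverts G)"
    using deck size_deck by metis
  have below: "card {A \<in> stable_sets (with_proj G). card A = i}
      = card {A \<in> stable_sets (with_proj H). card A = i}" if "i < card (pverts G)" for i
    using support_count_eq_if_deck_eq[OF G H deck that, of "{#i#}"]
    by (simp add: support_count_singleton G.pair_finite_verts H.pair_finite_verts)
  consider "j < card (pverts G)" | "j > card (pverts G)" | "j = card (pverts G)"
    by linarith
  then show ?thesis
  proof cases
    case 1
    then show ?thesis by (rule below)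
  next
    case 2
    then have "{A \<in> stable_sets (with_proj G). card A = j} = {}"
        "{A \<in> stable_sets (with_proj H). card A = j} = {}"
      using card_stable_set_le[of "with_proj G"] card_stable_set_le[of "with_proj H"] n
      by (force simp: G.pair_finite_verts H.pair_finite_verts)+
    then show ?thesis by (simp only: card.empty)
  next
    case 3
    have "pverts G \<in> stable_sets (with_proj G) \<longleftrightarrow> pverts H \<in> stable_sets (with_proj H)"
    proof (cases "card (pverts G) > 2")
      case True
      then show ?thesis
        using below[of 2] n by (simp add: verts_stable_iff_pairs_stable G H)
    next
      case False
      \<comment> \<open>There is at most one vertex and there are no loops, so the vertex set is stable unless empty.\<close>
      then have le: "card (pverts G) \<le> Suc 0" "card (pverts H) \<le> Suc 0"
        using not_2 n by auto
      have "(u, v) \<notin> parcs G" if "u \<in> pverts G" "v \<in> pverts G" for u v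
        using that le(1) G.pair_no_loops[of "(u, v)"]
        by (auto simp: card_le_Suc0_iff_eq[OF G.pair_finite_verts])
      moreover have "(u, v) \<notin> parcs H" if "u \<in> pverts H" "v \<in> pverts H" for u v
        using that le(2) H.pair_no_loops[of "(u, v)"]
        by (auto simp: card_le_Suc0_iff_eq[OF H.pair_finite_verts])
      moreover have "pverts G = {} \<longleftrightarrow> pverts H = {}"
        using n G.pair_finite_verts H.pair_finite_verts by (metis card_0_eq)
      ultimately show ?thesis
        by (simp add: stable_sets_def)
    qed
    moreover have "{A \<in> stable_sets (with_proj G). card A = j}
        = (if pverts G \<in> stable_sets (with_proj G) then {pverts G} else {})"
      using 3 card_subset_eq[OF G.pair_finite_verts] by (auto simp: stable_sets_def)
    moreover have "{A \<in> stable_sets (with_proj H). card A = j}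
        = (if pverts H \<in> stable_sets (with_proj H) then {pverts H} else {})"
      using 3 n card_subset_eq[OF H.pair_finite_verts] by (auto simp: stable_sets_def)
    ultimately show ?thesis
      by simp
  qed
qed

section \<open>Stable partitions\<close>

lemma disjoint_if_sum_card_eq:
  assumes fin: "finite F" "\<And>A. A \<in> F \<Longrightarrow> finite A"
    and sum: "(\<Sum>A\<in>F. card A) = card (\<Union>F)"
  shows "disjoint F"
proof (rule disjointI)
  fix A B assume AB: "A \<in> F" "B \<in> F" "A \<noteq> B"
  let ?R = "\<Union>(F - {A})"
  have finR: "finite A" "finite ?R"
    using fin AB by auto
  have "A \<union> ?R = \<Union>F"
    using AB by auto
  then have "card A + (\<Sum>C\<in>F - {A}. card C) = card (A \<union> ?R)"
    using sum sum.remove[OF fin(1) AB(1), of card] by simp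
  moreover have "card ?R \<le> (\<Sum>C\<in>F - {A}. card C)"
    by (rule card_Union_le_sum_card)
  moreover have "card A + card ?R = card (A \<union> ?R) + card (A \<inter> ?R)"
    using finR by (rule card_Un_Int)
  ultimately have "card (A \<inter> ?R) = 0"
    by linarith
  then show "A \<inter> B = {}"
    using AB finR by auto
qed

text \<open>
  The block sizes of a partition always sum to \<open>n\<close>; conversely, this sum makes a covering
  family disjoint.
\<close>

lemma card_stable_partitions:
  assumes "pair_graph G"
  shows "card {\<pi>. stable_partition G \<pi> \<and> block_sizes \<pi> = \<mu>}
    = (if \<Sum>\<^sub># \<mu> = card (pverts G) then support_count (with_proj G) \<mu> (card (pverts G)) else 0)"
proof -
  interpret pair_graph G by fact
  have fin: "finite (pverts G)"
    by (rule pair_finite_verts)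
  have stable: "stable_partition G \<pi> \<longleftrightarrow>
      \<pi> \<subseteq> stable_sets (with_proj G) \<and> \<Union>\<pi> = pverts G \<and> disjoint \<pi>" for \<pi>
    by (auto simp: stable_partition_def partition_on_def stable_sets_def)
  have disjoint_iff: "disjoint \<pi> \<longleftrightarrow> \<Sum>\<^sub># (block_sizes \<pi>) = card (\<Union>\<pi>)"
    if "\<pi> \<subseteq> stable_sets (with_proj G)" for \<pi>
  proof -
    have "finite \<pi>" "\<And>A. A \<in> \<pi> \<Longrightarrow> finite A"
      using that finite_subset[OF _ finite_stable_sets[of "with_proj G"]] finite_subset[OF _ fin] fin
      by (auto simp: stable_sets_def)
    then show ?thesis
      unfolding sum_mset_block_sizes
      using card_Union_disjoint[of \<pi>] disjoint_if_sum_card_eq[of \<pi>] by metis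
  qed
  have whole: "\<Union>\<pi> = pverts G \<longleftrightarrow> card (\<Union>\<pi>) = card (pverts G)"
    if "\<pi> \<in> stable_families (with_proj G) \<mu>" for \<pi>
    using Union_stable_family_subset[OF that] card_subset_eq[OF fin] by (metis with_proj_simps(1))
  have "{\<pi>. stable_partition G \<pi> \<and> block_sizes \<pi> = \<mu>}
      = {\<pi> \<in> stable_families (with_proj G) \<mu>.
          card (\<Union>\<pi>) = card (pverts G) \<and> \<Sum>\<^sub># \<mu> = card (pverts G)}"
    using whole disjoint_iff by (fastforce simp: stable stable_families_def)
  then show ?thesis
    by (simp add: support_count_def)
qed

lemma chromatic_symmetric_function_coeff:
  fixes \<alpha> :: "nat \<Rightarrow>\<^sub>0 nat"
  assumes "pair_graph G"
  defines "\<tau> \<equiv> {# Poly_Mapping.lookup \<alpha> i. i \<in># mset_set (Poly_Mapping.keys \<alpha>) #}"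
  shows "chromatic_symmetric_function G \<alpha>
    = (\<Prod>i\<in>set_mset \<tau>. fact (count \<tau> i)) * int (card {\<pi>. stable_partition G \<pi> \<and> block_sizes \<pi> = \<tau>})"
proof -
  interpret pair_graph G by fact
  have fin: "finite {\<pi>. stable_partition G \<pi>}"
    by (rule finite_subset[OF _ finitely_many_partition_on[OF pair_finite_verts]])
      (auto simp: stable_partition_def)
  have "augmented_monomial_symmetric (block_sizes \<pi>) \<alpha>
      = (if block_sizes \<pi> = \<tau> then \<Prod>i\<in>set_mset \<tau>. fact (count \<tau> i) else 0)" for \<pi> :: "'a set set"
    unfolding augmented_monomial_symmetric_def monomial_symmetric_def \<tau>_def by simp
  then show ?thesis
    using fin by (simp add: chromatic_symmetric_function_def sum.If_cases Int_def)
qed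

theorem proposition25:
  fixes G :: "'a pair_pre_digraph" and H :: "'b pair_pre_digraph"
  assumes "pair_graph G" and "pair_graph H"
    and "card (pverts G) \<noteq> 2"
    and "deck G = deck H"
  shows "chromatic_symmetric_function G = chromatic_symmetric_function H"
proof
  fix \<alpha>
  interpret G: pair_graph G by fact
  interpret H: pair_graph H by fact
  let ?n = "card (pverts G)"
  have n: "card (pverts H) = ?n"
    using assms(4) size_deck by metis
  have "support_count (with_proj G) \<mu> ?n = support_count (with_proj H) \<mu> ?n" for \<mu>
  proof -
    have "(\<Sum>j\<le>?n. support_count (with_proj G) \<mu> j) = card (stable_families (with_proj G) \<mu>)"
      using card_stable_families_eq_sum[of "with_proj G"] G.pair_finite_verts by simp
    also have "\<dots> = card (stable_families (with_proj H) \<mu>)"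
      using card_stable_sets_eq_if_deck_eq[OF assms(1,2,4,3)]
      by (intro card_stable_families_cong) (auto simp: G.pair_finite_verts H.pair_finite_verts)
    also have "\<dots> = (\<Sum>j\<le>?n. support_count (with_proj H) \<mu> j)"
      using card_stable_families_eq_sum[of "with_proj H"] H.pair_finite_verts n by simp
    finally show ?thesis
      using support_count_eq_if_deck_eq[OF assms(1,2,4)]
      by (simp add: lessThan_Suc_atMost[symmetric])
  qed
  then have "card {\<pi>. stable_partition G \<pi> \<and> block_sizes \<pi> = \<mu>}
      = card {\<pi>. stable_partition H \<pi> \<and> block_sizes \<pi> = \<mu>}" for \<mu>
    using assms(1,2) n by (simp add: card_stable_partitions)
  then show "chromatic_symmetric_function G \<alpha> = chromatic_symmetric_function H \<alpha>"
    using assms(1,2) by (simp add: chromatic_symmetric_function_coeff)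
qed

end
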